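(* For every integer $k\ge 1$, the Gromov--Hausdorff distance between the circle $S^1$ and the sphere $S^{2k+1}$, each equipped with its geodesic metric, satisfies $$2\cdot d_{\mathrm{GH}}(S^1,S^{2k+1})\le \frac{2\pi k}{2k+1}.$$
   Context: $S^1=\mathbb{R}/2\pi\mathbb{Z}$ with the geodesic metric $d(t,t')=\min_{j\in\mathbb{Z}}|t-t'+2\pi j|$. $S^{2k+1}$ is the unit sphere in $\mathbb{R}^{2k+2}$ with the geodesic metric $d(x,x')=\arccos\langle x,x'\rangle$. The Gromov--Hausdorff distance $d_{\mathrm{GH}}$ between compact metric spaces $X,Y$ can be defined by $$2\cdot d_{\mathrm{GH}}(X,Y)=\inf_{f,h}\max\{\mathrm{dis}(f),\mathrm{dis}(h),\mathrm{codis}(f,h)\},$$ where the infimum is over all (possibly discontinuous) functions $f\colon X\to Y$ and $h\colon Y\to X$. Here the distortion of $f$ is $\mathrm{dis}(f)=\sup_{x,x'\in X}|d(x,x')-d(f(x),f(x'))|$ (and similarly for $h$), and the codistortion of $f$ and $h$ is $\mathrm{codis}(f,h)=\sup_{x\in X,\,y\in Y}|d(x,h(y))-d(f(x),y)|$. *)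

theory Defs
  imports "HOL-Analysis.Analysis"
begin

definition distortion :: "'a set \<Rightarrow> ('a \<Rightarrow> 'a \<Rightarrow> real) \<Rightarrow> ('b \<Rightarrow> 'b \<Rightarrow> real) \<Rightarrow> ('a \<Rightarrow> 'b) \<Rightarrow> real"
  where "distortion X dX dY f = (SUP (x, x') \<in> X \<times> X. \<bar>dX x x' - dY (f x) (f x')\<bar>)"

definition codistortion ::
    "'a set \<Rightarrow> ('a \<Rightarrow> 'a \<Rightarrow> real) \<Rightarrow> 'b set \<Rightarrow> ('b \<Rightarrow> 'b \<Rightarrow> real) \<Rightarrow> ('a \<Rightarrow> 'b) \<Rightarrow> ('b \<Rightarrow> 'a) \<Rightarrow> real"
  where "codistortion X dX Y dY f h = (SUP (x, y) \<in> X \<times> Y. \<bar>dX x (h y) - dY (f x) y\<bar>)"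

text \<open>
  The suprema and the infimum are taken in the reals. They are the genuine ones whenever
  \<open>X\<close> and \<open>Y\<close> are nonempty and bounded, in particular for nonempty compact metric spaces.
\<close>

definition gromov_hausdorff_dist ::
    "'a set \<Rightarrow> ('a \<Rightarrow> 'a \<Rightarrow> real) \<Rightarrow> 'b set \<Rightarrow> ('b \<Rightarrow> 'b \<Rightarrow> real) \<Rightarrow> real"
  where "gromov_hausdorff_dist X dX Y dY =
    (INF (f, h) \<in> (X \<rightarrow> Y) \<times> (Y \<rightarrow> X).
       Max {distortion X dX dY f, distortion Y dY dX h, codistortion X dX Y dY f h}) / 2"

definition circle_rel :: "real \<Rightarrow> real \<Rightarrow> bool"
  where "circle_rel s t \<longleftrightarrow> (\<exists>j::int. s - t = 2 * pi * of_int j)"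

lemma equivp_circle_rel: "equivp circle_rel"
proof (rule equivpI)
  show "reflp circle_rel"
    by (auto simp: reflp_def circle_rel_def intro: exI[of _ 0])
  show "symp circle_rel"
  proof (rule sympI)
    fix s t assume "circle_rel s t"
    then obtain j :: int where "s - t = 2 * pi * of_int j"
      by (auto simp: circle_rel_def)
    then have "t - s = 2 * pi * of_int (- j)"
      by simp
    then show "circle_rel t s"
      unfolding circle_rel_def by blast
  qed
  show "transp circle_rel"
  proof (rule transpI)
    fix s t u assume "circle_rel s t" "circle_rel t u"
    then obtain i j :: int where "s - t = 2 * pi * of_int i" "t - u = 2 * pi * of_int j"
      by (auto simp: circle_rel_def)
    then have "s - u = 2 * pi * of_int (i + j)"
      by (simp add: algebra_simps)
    then show "circle_rel s u"
      unfolding circle_rel_def by blast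
  qed
qed

quotient_type circle = real / circle_rel
  by (rule equivp_circle_rel)

lift_definition circle_dist :: "circle \<Rightarrow> circle \<Rightarrow> real"
  is "\<lambda>t t'. INF j::int. \<bar>t - t' + 2 * pi * of_int j\<bar>"
proof -
  fix s s' t t' assume "circle_rel s s'" "circle_rel t t'"
  then obtain i j :: int where ij: "s - s' = 2 * pi * of_int i" "t - t' = 2 * pi * of_int j"
    by (auto simp: circle_rel_def)
  let ?f = "\<lambda>n::int. \<bar>s - t + 2 * pi * of_int n\<bar>"
  let ?g = "\<lambda>n::int. \<bar>s' - t' + 2 * pi * of_int n\<bar>"
  have eq: "?f n = ?g (n + (i - j))" for n
    by (rule arg_cong[of _ _ abs]) (use ij in \<open>simp add: algebra_simps\<close>)
  then have "range ?f = ?g ` range (\<lambda>n. n + (i - j))"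
    by (simp only: eq image_image)
  also have "range (\<lambda>n. n + (i - j)) = UNIV"
    by (rule surjI[of _ "\<lambda>n. n - (i - j)"]) simp
  finally show "(INF n. ?f n) = (INF n. ?g n)"
    by simp
qed

text \<open>The infimum is attained, so it is the minimum over \<open>j\<close>.\<close>

lemma circle_dist_attained:
  "\<exists>j::int. circle_dist (abs_circle t) (abs_circle t') = \<bar>t - t' + 2 * pi * of_int j\<bar>"
    and circle_dist_le: "circle_dist (abs_circle t) (abs_circle t') \<le> \<bar>t - t' + 2 * pi * of_int j\<bar>"
proof -
  let ?f = "\<lambda>n::int. \<bar>t - t' + 2 * pi * of_int n\<bar>"
  have bdd: "bdd_below (range ?f)"
    by (rule bdd_belowI[of _ 0]) auto
  show "circle_dist (abs_circle t) (abs_circle t') \<le> ?f j"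
    unfolding circle_dist.abs_eq by (rule cINF_lower[OF bdd]) simp
  define m where "m = - round ((t - t') / (2 * pi))"
  have "?f m \<le> ?f n" for n
  proof -
    have eq: "?f l = 2 * pi * \<bar>(t - t') / (2 * pi) - of_int (- l)\<bar>" for l
    proof -
      have "t - t' + 2 * pi * of_int l = 2 * pi * ((t - t') / (2 * pi) - of_int (- l))"
        by (simp add: field_simps)
      then show ?thesis
        by (simp only: abs_mult) simp
    qed
    show ?thesis
      unfolding eq m_def using round_diff_minimal[of "(t - t') / (2 * pi)" "- n"] by simp
  qed
  then have "(INF n. ?f n) = ?f m"
    by (intro antisym cINF_greatest cINF_lower bdd) auto
  then show "\<exists>j::int. circle_dist (abs_circle t) (abs_circle t') = ?f j"
    unfolding circle_dist.abs_eq by blast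
qed

lemma Metric_space_circle: "Metric_space UNIV circle_dist"
proof
  fix x y z :: circle
  obtain s t u where [simp]: "x = abs_circle s" "y = abs_circle t" "z = abs_circle u"
    by (induction x rule: circle.abs_induct, induction y rule: circle.abs_induct,
        induction z rule: circle.abs_induct) blast
  obtain j :: int where j: "circle_dist x y = \<bar>s - t + 2 * pi * of_int j\<bar>"
    using circle_dist_attained by auto
  obtain i :: int where i: "circle_dist y x = \<bar>t - s + 2 * pi * of_int i\<bar>"
    using circle_dist_attained by auto
  obtain l :: int where l: "circle_dist y z = \<bar>t - u + 2 * pi * of_int l\<bar>"
    using circle_dist_attained by auto
  show "0 \<le> circle_dist x y"
    unfolding j by simp
  show "circle_dist x y = circle_dist y x"
    using circle_dist_le[of s t "- i"] circle_dist_le[of t s "- j"] i j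
    by (auto simp: abs_if split: if_splits)
  show "circle_dist x y = 0 \<longleftrightarrow> x = y"
  proof
    assume "circle_dist x y = 0"
    then have "s - t = 2 * pi * of_int (- j)"
      using j by simp
    then show "x = y"
      by (simp add: circle.abs_eq_iff circle_rel_def) (metis of_int_minus mult_minus_right)
  next
    assume "x = y"
    then show "circle_dist x y = 0"
      using circle_dist_le[of t t 0] circle_dist_attained[of t t] by fastforce
  qed
  have "circle_dist x z \<le> \<bar>s - u + 2 * pi * of_int (j + l)\<bar>"
    using circle_dist_le[of s u "j + l"] by simp
  also have "\<dots> \<le> circle_dist x y + circle_dist y z"
    unfolding j l by (simp add: algebra_simps)
  finally show "circle_dist x z \<le> circle_dist x y + circle_dist y z" .
qed

definition sphere_dist :: "'a::real_inner \<Rightarrow> 'a \<Rightarrow> real"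
  where "sphere_dist x y = arccos (x \<bullet> y)"

text \<open>
  On the unit sphere this is a metric. Off the sphere \<open>arccos\<close> may be applied outside
  its domain, so the properties are stated relative to the carrier.
\<close>

lemma sphere_dist_commute: "sphere_dist x y = sphere_dist y x"
  by (simp add: sphere_dist_def inner_commute)

context
  fixes x y :: "'a::real_inner"
  assumes xy: "x \<in> sphere 0 1" "y \<in> sphere 0 1"
begin

lemma sphere_inner_bound: "\<bar>x \<bullet> y\<bar> \<le> 1"
  using Cauchy_Schwarz_ineq2[of x y] xy by simp

lemma sphere_dist_nonneg: "0 \<le> sphere_dist x y"
  and sphere_dist_le_pi: "sphere_dist x y \<le> pi"
  and cos_sphere_dist: "cos (sphere_dist x y) = x \<bullet> y"
  using sphere_inner_bound by (auto simp: sphere_dist_def abs_le_iff intro: arccos_lbound arccos_ubound)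

lemma sphere_dist_eq_0_iff: "sphere_dist x y = 0 \<longleftrightarrow> x = y"
proof
  assume "sphere_dist x y = 0"
  then have "x \<bullet> y = 1"
    using cos_sphere_dist by simp
  then have "(norm (x - y))\<^sup>2 = 0"
    using xy by (simp add: power2_norm_eq_inner inner_diff inner_commute norm_eq_1)
  then show "x = y"
    by simp
next
  assume "x = y"
  then show "sphere_dist x y = 0"
    using xy by (simp add: sphere_dist_def norm_eq_1)
qed

end

lemma sphere_dist_triangle:
  fixes x y z :: "'a::real_inner"
  assumes x: "x \<in> sphere 0 1" and y: "y \<in> sphere 0 1" and z: "z \<in> sphere 0 1"
  shows "sphere_dist x z \<le> sphere_dist x y + sphere_dist y z"
proof (cases "sphere_dist x y + sphere_dist y z \<le> pi")
  case False
  then show ?thesis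
    using sphere_dist_le_pi[OF x z] by linarith
next
  case True
  let ?a = "sphere_dist x y" and ?b = "sphere_dist y z"
  have ab: "0 \<le> ?a" "?a \<le> pi" "0 \<le> ?b" "?b \<le> pi"
    using sphere_dist_nonneg sphere_dist_le_pi x y z by blast+
  have c: "cos ?a = x \<bullet> y" "cos ?b = y \<bullet> z"
    using cos_sphere_dist x y z by blast+
  have unit: "x \<bullet> x = 1" "y \<bullet> y = 1" "z \<bullet> z = 1"
    using x y z by (simp_all add: norm_eq_1)
  let ?u = "x - (x \<bullet> y) *\<^sub>R y" and ?v = "z - (y \<bullet> z) *\<^sub>R y"
  have "(norm ?u)\<^sup>2 = (sin ?a)\<^sup>2"
    unfolding power2_norm_eq_inner sin_squared_eq c
    by (simp add: inner_diff inner_commute unit power2_eq_square)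
  then have u: "norm ?u = sin ?a"
    using ab by (simp add: sin_ge_zero)
  have "(norm ?v)\<^sup>2 = (sin ?b)\<^sup>2"
    unfolding power2_norm_eq_inner sin_squared_eq c
    by (simp add: inner_diff inner_commute unit power2_eq_square)
  then have v: "norm ?v = sin ?b"
    using ab by (simp add: sin_ge_zero)
  have "cos (?a + ?b) = (x \<bullet> y) * (y \<bullet> z) - norm ?u * norm ?v"
    by (simp add: cos_add c u v)
  also have "\<dots> \<le> (x \<bullet> y) * (y \<bullet> z) + ?u \<bullet> ?v"
    using Cauchy_Schwarz_ineq2[of ?u ?v] by linarith
  also have "\<dots> = x \<bullet> z"
    by (simp add: inner_diff inner_commute unit)
  also have "\<dots> = cos (sphere_dist x z)"
    by (simp add: cos_sphere_dist[OF x z])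
  finally show ?thesis
    using cos_mono_le_eq[of "?a + ?b" "sphere_dist x z"] ab True
      sphere_dist_nonneg[OF x z] sphere_dist_le_pi[OF x z] by simp
qed

end

theory Submission imports Defs begin

text \<open>
  Relate \<open>x\<close> on the sphere to \<open>t\<close> on the circle when \<open>\<gamma> t\<close> is a nearest point to \<open>x\<close> on the symmetric
  trigonometric moment curve \<open>\<gamma> t = (cos t, sin t, cos 3t, sin 3t, \<dots>, cos (2k+1)t, sin (2k+1)t) / sqrt (k+1)\<close>,
  that is, when \<open>t\<close> maximizes the trigonometric polynomial \<open>Q s = \<langle>x, \<gamma> s\<rangle>\<close> of degree \<open>N = 2k+1\<close>.
  This relation is total on both sides and invariant under the antipodal maps, so bounding its
  distortion by \<open>pi - pi/N\<close> reduces to the one-sided estimate \<open>d(x, y) \<le> pi - pi/N + d(t, t')\<close>.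

  By an inequality of M. Riesz, \<open>Q s \<ge> Q t cos (N (s - t))\<close> for \<open>s\<close> within \<open>pi/N\<close> of the maximum point \<open>t\<close>,
  and \<open>Q t \<ge> 1 / sqrt (2k+2)\<close> since the curve passes through an orthonormal basis. Hence if \<open>t\<close> and
  \<open>t'\<close> are close, then \<open>x\<close> and \<open>y\<close> are both close to the point of the curve at the midpoint of \<open>t\<close> and
  \<open>t'\<close>, and the triangle inequality gives the estimate.
\<close>

section \<open>Trigonometric polynomials with odd frequencies\<close>

text \<open>With complex coefficients a translation multiplies each coefficient by a phase and a
  reflection conjugates it. Odd frequencies make these functions antiperiodic under
  \<open>pi\<close>.\<close>

definition odd_trig :: "nat \<Rightarrow> (real \<Rightarrow> real) \<Rightarrow> bool"
  where "odd_trig k Q \<longleftrightarrow>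
    (\<exists>c :: nat \<Rightarrow> complex. \<forall>s. Q s = (\<Sum>j\<le>k. Re (c j * cis (real (2 * j + 1) * s))))"

lemma odd_trigI:
  assumes "\<And>s. Q s = (\<Sum>j\<le>k. Re (c j * cis (real (2 * j + 1) * s)))"
  shows "odd_trig k Q"
  using assms unfolding odd_trig_def by blast

lemma odd_trig_diff:
  assumes "odd_trig k P" "odd_trig k Q"
  shows "odd_trig k (\<lambda>s. P s - Q s)"
proof -
  obtain c d where "\<And>s. P s = (\<Sum>j\<le>k. Re (c j * cis (real (2 * j + 1) * s)))"
    and "\<And>s. Q s = (\<Sum>j\<le>k. Re (d j * cis (real (2 * j + 1) * s)))"
    using assms unfolding odd_trig_def by blast
  then show ?thesis
    by (intro odd_trigI[where c = "\<lambda>j. c j - d j"])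
       (simp add: sum_subtractf[symmetric] left_diff_distrib del: cis.simps)
qed

lemma odd_trig_cmult:
  assumes "odd_trig k Q"
  shows "odd_trig k (\<lambda>s. r * Q s)"
proof -
  obtain c where "\<And>s. Q s = (\<Sum>j\<le>k. Re (c j * cis (real (2 * j + 1) * s)))"
    using assms unfolding odd_trig_def by blast
  then show ?thesis
    by (intro odd_trigI[where c = "\<lambda>j. of_real r * c j"])
       (simp add: sum_distrib_left mult.assoc Re_complex_of_real del: cis.simps)
qed

lemma odd_trig_translate:
  assumes "odd_trig k Q"
  shows "odd_trig k (\<lambda>s. Q (t + s))"
proof -
  obtain c where "\<And>s. Q s = (\<Sum>j\<le>k. Re (c j * cis (real (2 * j + 1) * s)))"
    using assms unfolding odd_trig_def by blast
  then show ?thesis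
    by (intro odd_trigI[where c = "\<lambda>j. c j * cis (real (2 * j + 1) * t)"])
       (simp only: mult.assoc cis_mult distrib_left)
qed

lemma odd_trig_reflect:
  assumes "odd_trig k Q"
  shows "odd_trig k (\<lambda>s. Q (- s))"
proof -
  obtain c where c: "\<And>s. Q s = (\<Sum>j\<le>k. Re (c j * cis (real (2 * j + 1) * s)))"
    using assms unfolding odd_trig_def by blast
  have "Re (c j * cis (real (2 * j + 1) * - s)) = Re (cnj (c j) * cis (real (2 * j + 1) * s))" for j s
    by simp
  then show ?thesis
    by (intro odd_trigI[where c = "\<lambda>j. cnj (c j)"]) (simp only: c)
qed

lemma odd_trig_cos: "odd_trig k (\<lambda>s. r * cos (real (2 * k + 1) * (s + b)))"
proof (rule odd_trigI)
  fix s
  let ?c = "\<lambda>j. if j = k then of_real r * cis (real (2 * k + 1) * b) else 0"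
  have "(\<Sum>j\<le>k. Re (?c j * cis (real (2 * j + 1) * s)))
      = (\<Sum>j\<le>k. if j = k then Re (of_real r * cis (real (2 * k + 1) * b) * cis (real (2 * k + 1) * s)) else 0)"
    by (rule sum.cong) auto
  also have "\<dots> = Re (of_real r * (cis (real (2 * k + 1) * b) * cis (real (2 * k + 1) * s)))"
    by (simp add: mult.assoc del: cis.simps)
  also have "\<dots> = r * cos (real (2 * k + 1) * (s + b))"
    by (simp add: cis_mult algebra_simps)
  finally show "r * cos (real (2 * k + 1) * (s + b)) = (\<Sum>j\<le>k. Re (?c j * cis (real (2 * j + 1) * s)))"
    by simp
qed

lemma odd_trig_continuous:
  assumes "odd_trig k Q"
  shows "continuous_on S Q"
proof -
  obtain c where "Q = (\<lambda>s. \<Sum>j\<le>k. Re (c j * cis (real (2 * j + 1) * s)))"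
    using assms unfolding odd_trig_def by blast
  then show ?thesis
    by (auto intro!: continuous_intros)
qed

lemma odd_trig_antiperiodic:
  assumes "odd_trig k Q"
  shows "Q (s + pi) = - Q s"
proof -
  obtain c where c: "\<And>s. Q s = (\<Sum>j\<le>k. Re (c j * cis (real (2 * j + 1) * s)))"
    using assms unfolding odd_trig_def by blast
  have "cis (real (2 * j + 1) * (s + pi)) = - cis (real (2 * j + 1) * s)" for j
  proof -
    have "cis (real (2 * j + 1) * (s + pi)) = cis (real (2 * j + 1) * s) * (cis (2 * pi) ^ j * cis pi)"
      unfolding Complex.DeMoivre cis_mult by (rule arg_cong[of _ _ cis]) (simp add: algebra_simps)
    then show ?thesis
      by simp
  qed
  then show ?thesis
    by (simp only: c mult_minus_right uminus_complex.simps sum_negf)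
qed

lemma odd_trig_periodic:
  assumes "odd_trig k Q"
  shows "Q (s + 2 * pi * of_int n) = Q s"
proof -
  have shift: "Q (s + 2 * pi) = Q s" for s
    using odd_trig_antiperiodic[OF assms, of "s + pi"] odd_trig_antiperiodic[OF assms, of s]
    by (simp add: algebra_simps)
  have nat: "Q (s + 2 * pi * real m) = Q s" for s m
  proof (induction m)
    case (Suc m)
    then show ?case
      using shift[of "s + 2 * pi * real m"] by (simp add: algebra_simps)
  qed simp
  show ?thesis
  proof (cases n rule: int_cases2)
    case (nonneg m)
    then show ?thesis
      using nat by simp
  next
    case (nonpos m)
    then show ?thesis
      using nat[of "s - 2 * pi * real m" m] by simp
  qed
qed

text \<open>A degree count: up to a unit factor \<open>Q\<close> is a polynomial of degree at most
  \<open>2 * k + 1\<close> in \<open>cis (2 * s)\<close>, which is injective in \<open>s\<close> on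
  a half-open interval of length \<open>pi\<close>.\<close>

lemma odd_trig_eq_0:
  assumes Q: "odd_trig k Q" and Z: "card Z = 2 * k + 2" "Z \<subseteq> {a..<a + pi}"
    and zero: "\<And>z. z \<in> Z \<Longrightarrow> Q z = 0"
  shows "Q s = 0"
proof -
  obtain c where c: "\<And>s. Q s = (\<Sum>j\<le>k. Re (c j * cis (real (2 * j + 1) * s)))"
    using Q unfolding odd_trig_def by blast
  \<comment> \<open>multiplying by \<open>exp (i (2k+1) s)\<close> turns \<open>Q\<close> into a polynomial in \<open>exp (2 i s)\<close>\<close>
  define P where "P = (\<Sum>j\<le>k. monom (c j / 2) (k + j + 1) + monom (cnj (c j) / 2) (k - j))"
  have P: "poly P (cis (2 * s)) = of_real (Q s) * cis (real (2 * k + 1) * s)" for s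
  proof -
    have "poly (monom (c j / 2) (k + j + 1) + monom (cnj (c j) / 2) (k - j)) (cis (2 * s))
        = of_real (Re (c j * cis (real (2 * j + 1) * s))) * cis (real (2 * k + 1) * s)"
      if "j \<le> k" for j
    proof -
      have 1: "cis (2 * s) ^ (k + j + 1) = cis (real (2 * j + 1) * s) * cis (real (2 * k + 1) * s)"
        unfolding Complex.DeMoivre cis_mult by (rule arg_cong[of _ _ cis]) (simp add: algebra_simps)
      have "real (k - j) = real k - real j"
        using that by simp
      then have 2: "cis (2 * s) ^ (k - j) = cnj (cis (real (2 * j + 1) * s)) * cis (real (2 * k + 1) * s)"
        by (simp only: Complex.DeMoivre cis_mult cis_cnj, intro arg_cong[of _ _ cis]) (simp add: algebra_simps)
      have "of_real (Re w) = (w + cnj w) / 2" for w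
        by (simp add: complex_add_cnj)
      then show ?thesis
        by (simp only: poly_add poly_monom 1 2 complex_cnj_mult) (simp add: field_simps del: cis.simps)
    qed
    then show ?thesis
      by (simp add: P_def poly_sum c sum_distrib_right del: cis.simps)
  qed
  have "P = 0"
  proof (rule ccontr)
    assume "P \<noteq> 0"
    have "degree P \<le> 2 * k + 1"
      unfolding P_def by (intro degree_sum_le degree_add_le order_trans[OF degree_monom_le]) auto
    moreover have "card {z. poly P z = 0} \<le> degree P"
      using \<open>P \<noteq> 0\<close> by (rule card_poly_roots_bound)
    moreover have "card ((\<lambda>s. cis (2 * s)) ` Z) \<le> card {z. poly P z = 0}"
      using \<open>P \<noteq> 0\<close> zero by (intro card_mono poly_roots_finite) (auto simp: P)
    moreover have "inj_on (\<lambda>s. cis (2 * s)) Z"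
    proof (rule inj_onI)
      fix x y assume xy: "x \<in> Z" "y \<in> Z" and eq: "cis (2 * x) = cis (2 * y)"
      then have "sin (2 * x) = sin (2 * y)" "cos (2 * x) = cos (2 * y)"
        by (metis cis.simps)+
      then obtain n :: int where "2 * x = 2 * y + 2 * pi * of_int n"
        using sin_cos_eq_iff by metis
      then have n: "x - y = pi * of_int n"
        by simp
      moreover have "\<bar>x - y\<bar> < pi"
        using subsetD[OF Z(2) xy(1)] subsetD[OF Z(2) xy(2)] by (auto simp: abs_less_iff)
      ultimately have "\<bar>pi * of_int n\<bar> < pi * 1"
        by simp
      then have "n = 0"
        by (simp only: abs_mult) (simp add: mult_less_cancel_left)
      then show "x = y"
        using n by simp
    qed
    ultimately show False
      using Z(1) by (simp add: card_image)
  qed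
  then show ?thesis
    using P[of s] by simp
qed

section \<open>Comparison with the extremal cosine (M. Riesz)\<close>

lemma sign_change_zero:
  fixes f :: "real \<Rightarrow> real"
  assumes "a < b" "continuous_on {a..b} f" "f a * f b < 0"
  shows "\<exists>z. a < z \<and> z < b \<and> f z = 0"
proof -
  have "\<exists>z. a \<le> z \<and> z \<le> b \<and> f z = 0"
  proof (cases "f a < 0")
    case True
    then show ?thesis
      using assms IVT'[of f a 0 b] by (auto simp: mult_less_0_iff)
  next
    case False
    then show ?thesis
      using assms IVT2'[of f b 0 a] by (auto simp: mult_less_0_iff)
  qed
  then obtain z where "a \<le> z" "z \<le> b" "f z = 0"
    by blast
  then show ?thesis
    using assms(3) by (intro exI[of _ z]) (auto simp: less_le)
qed

text \<open>
  Were the inequality false, the difference \<open>M cos (N (s + b)) - cos (N b) Q s\<close>, \<open>N = 2k+1\<close>,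
  would have two zeros on its first monotone branch (one of them at 0) and one on each of the
  other \<open>N - 1\<close> branches.
\<close>

lemma odd_trig_comparison:
  assumes Q: "odd_trig k Q" and bound: "\<And>s. \<bar>Q s\<bar> \<le> M" and max: "Q 0 = M" and "0 < M"
    and b: "0 < b" and tau: "0 < \<tau>" "real (2 * k + 1) * (\<tau> + b) < pi"
  shows "M * cos (real (2 * k + 1) * (\<tau> + b)) \<le> cos (real (2 * k + 1) * b) * Q \<tau>"
proof (rule ccontr)
  assume contra: "\<not> ?thesis"
  define N where "N = real (2 * k + 1)"
  have N: "1 \<le> N" "0 < N"
    by (simp_all add: N_def)
  define D where "D = (\<lambda>s. M * cos (N * (s + b)) - cos (N * b) * Q s)"
  have D: "odd_trig k D"
    unfolding D_def N_def by (intro odd_trig_diff odd_trig_cos odd_trig_cmult Q)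
  then have cont: "continuous_on S D" for S
    by (rule odd_trig_continuous)
  \<comment> \<open>These are the extrema of \<open>cos (N * (s + b))\<close>. There
    \<open>D\<close> has the strict sign \<open>(-1) ^ i\<close>, because
    \<open>\<bar>cos (N * b)\<bar> < 1\<close>.\<close>
  define p where "p = (\<lambda>i::nat. real i * pi / N - b)"
  have Nb: "0 < N * b" "N * b < pi"
    using b tau N by (auto simp: N_def distrib_left) (smt (verit) mult_pos_pos of_nat_0_le_iff)
  have c: "\<bar>cos (N * b)\<bar> < 1"
    using cos_monotone_0_pi[of 0 "N * b"] cos_monotone_0_pi[of "N * b" pi] Nb by auto
  have sign: "0 < (-1) ^ i * D (p i)" for i
  proof -
    have "N * (p i + b) = real i * pi"
      using N by (simp add: p_def)
    then have "(-1) ^ i * D (p i) = M - (-1) ^ i * (cos (N * b) * Q (p i))"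
      by (simp add: D_def right_diff_distrib flip: power_add power_mult_distrib)
    moreover have "\<bar>(-1) ^ i * (cos (N * b) * Q (p i))\<bar> \<le> \<bar>cos (N * b)\<bar> * M"
      using bound by (simp add: abs_mult power_abs mult_left_mono)
    moreover have "\<bar>cos (N * b)\<bar> * M < M"
      using c \<open>0 < M\<close> by simp
    ultimately show ?thesis
      by linarith
  qed
  have p_Suc: "p (Suc i) = p i + pi / N" for i
    by (simp add: p_def algebra_simps add_divide_distrib)
  have p_mono: "p i \<le> p j" if "i \<le> j" for i j
    using that N by (simp add: p_def divide_right_mono mult_right_mono)
  have "\<exists>z. p i < z \<and> z < p (Suc i) \<and> D z = 0" for i
  proof (rule sign_change_zero[OF _ cont])
    show "p i < p (Suc i)"
      using N by (simp add: p_Suc)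
    have "0 < ((-1) ^ i * D (p i)) * ((-1) ^ Suc i * D (p (Suc i)))"
      by (intro mult_pos_pos sign)
    also have "\<dots> = - (((-1) ^ i * (-1) ^ i) * (D (p i) * D (p (Suc i))))"
      by simp
    also have "\<dots> = - (D (p i) * D (p (Suc i)))"
      by (simp flip: power_mult_distrib)
    finally show "D (p i) * D (p (Suc i)) < 0"
      by simp
  qed
  then obtain z where z: "\<And>i. p i < z i" "\<And>i. z i < p (Suc i)" "\<And>i. D (z i) = 0"
    by metis
  have z_mono: "z i < z j" if "i < j" for i j
    using z(2)[of i] p_mono[of "Suc i" j] z(1)[of j] that by simp
  \<comment> \<open>The negated claim gives the first branch a zero \<open>y\<close> beyond
    \<open>\<tau>\<close>, besides the zero at 0 that comes from \<open>Q 0 = M\<close>.\<close>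
  have "0 < D \<tau>"
    using contra by (simp add: D_def N_def)
  moreover have "D (p 1) < 0"
    using sign[of 1] by simp
  moreover have "\<tau> < p 1"
    using tau N by (simp add: p_def N_def field_simps)
  ultimately obtain y where y: "\<tau> < y" "y < p 1" "D y = 0"
    using sign_change_zero[OF _ cont, of \<tau> "p 1"] by (auto simp: mult_pos_neg)
  \<comment> \<open>\<open>z 0\<close> is left out because it may coincide with 0 or
    \<open>y\<close>. Branches 1 to \<open>2 * k\<close> complete the count, and all
    \<open>N\<close> branches of width \<open>pi / N\<close> together fill an interval of length
    \<open>pi\<close>.\<close>
  define Z where "Z = insert 0 (insert y (z ` {1..2 * k}))"
  have above: "y < z i" if "1 \<le> i" for i
    using y(2) p_mono[OF that] z(1)[of i] by simp
  have "inj_on z {1..2 * k}"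
    using z_mono by (intro linorder_inj_onI) (auto dest: less_imp_neq)
  then have "card (z ` {1..2 * k}) = 2 * k"
    by (simp add: card_image)
  moreover have "y \<notin> z ` {1..2 * k}" "0 \<notin> insert y (z ` {1..2 * k})"
    using above y tau by force+
  ultimately have "card Z = 2 * k + 2"
    by (simp add: Z_def)
  moreover have "Z \<subseteq> {p 0..<p 0 + pi}"
  proof -
    have "p (Suc (2 * k)) = p 0 + pi"
      using N by (simp add: p_def N_def)
    then have "z i < p 0 + pi" if "i \<le> 2 * k" for i
      using z(2)[of i] p_mono[of "Suc i" "Suc (2 * k)"] that by simp
    moreover have "p 0 \<le> z i" for i
      using z(1)[of i] p_mono[of 0 i] by simp
    moreover have "p 1 \<le> p 0 + pi"
      using N by (simp add: p_def divide_le_eq)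
    moreover have "p 0 < 0"
      using b by (simp add: p_def)
    ultimately show ?thesis
      using y tau by (auto simp: Z_def)
  qed
  moreover have "D u = 0" if "u \<in> Z" for u
    using that y z by (auto simp: Z_def D_def max)
  ultimately have "D (p 0) = 0"
    using odd_trig_eq_0[OF D] by blast
  then show False
    using sign[of 0] by simp
qed

text \<open>The limit of \<open>odd_trig_comparison\<close> as \<open>b\<close> decreases to 0. The
  positive shift there keeps the signs at the extrema strict and 0 inside the first branch.\<close>

lemma odd_trig_ge_cos_right:
  assumes Q: "odd_trig k Q" and bound: "\<And>s. \<bar>Q s\<bar> \<le> M" and max: "Q 0 = M" and "0 < M"
    and tau: "0 \<le> \<tau>" "real (2 * k + 1) * \<tau> < pi"
  shows "M * cos (real (2 * k + 1) * \<tau>) \<le> Q \<tau>"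
proof (cases "\<tau> = 0")
  case False
  define N where "N = real (2 * k + 1)"
  have N: "0 < N"
    by (simp add: N_def)
  have "((\<lambda>b. M * cos (N * (\<tau> + b))) \<longlongrightarrow> M * cos (N * (\<tau> + 0))) (at_right 0)"
    by (intro tendsto_intros)
  moreover have "((\<lambda>b. cos (N * b) * Q \<tau>) \<longlongrightarrow> cos (N * 0) * Q \<tau>) (at_right 0)"
    by (intro tendsto_intros)
  moreover have "\<forall>\<^sub>F b in at_right 0. M * cos (N * (\<tau> + b)) \<le> cos (N * b) * Q \<tau>"
  proof -
    have "0 < pi / N - \<tau>"
      using tau N by (simp add: N_def field_simps)
    then have "\<forall>\<^sub>F b in at_right 0. b \<in> {0<..<pi / N - \<tau>}"
      by (rule eventually_at_right_real)
    then show ?thesis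
    proof eventually_elim
      case (elim b)
      then have "N * (\<tau> + b) < pi"
        using N by (simp add: field_simps)
      then show ?case
        using odd_trig_comparison[OF Q bound max \<open>0 < M\<close>, of b \<tau>] elim tau False
        by (simp add: N_def)
    qed
  qed
  ultimately have "M * cos (N * (\<tau> + 0)) \<le> cos (N * 0) * Q \<tau>"
    by (intro tendsto_le[of "at_right 0"]) auto
  then show ?thesis
    by (simp add: N_def)
qed (simp add: max)

lemma odd_trig_ge_cos:
  assumes Q: "odd_trig k Q" and bound: "\<And>s. \<bar>Q s\<bar> \<le> M" and max: "Q t = M" and "0 < M"
    and s: "real (2 * k + 1) * \<bar>s - t\<bar> < pi"
  shows "M * cos (real (2 * k + 1) * (s - t)) \<le> Q s"
proof (cases "t \<le> s")
  case True
  then show ?thesis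
    using odd_trig_ge_cos_right[OF odd_trig_translate[OF Q, of t] bound _ \<open>0 < M\<close>, of "s - t"] s max
    by simp
next
  case False
  have "cos (real (2 * k + 1) * (t - s)) = cos (real (2 * k + 1) * (s - t))"
    by (metis cos_minus minus_diff_eq mult_minus_right)
  then show ?thesis
    using odd_trig_ge_cos_right[OF odd_trig_reflect[OF odd_trig_translate[OF Q, of t]] bound _ \<open>0 < M\<close>, of "t - s"]
      s max False
    by (simp add: abs_if)
qed

section \<open>A trigonometric sum and a sine inequality\<close>

text \<open>The products telescope. The right-hand side vanishes at multiples of
  \<open>pi / (2 * k + 2)\<close>, which gives the orthogonality behind
  \<open>parseval\<close>.\<close>

lemma sin_mult_sum_cos_odd:
  fixes x :: real
  shows "2 * sin x * (\<Sum>j\<le>k. cos (real (2 * j + 1) * x)) = sin (real (2 * k + 2) * x)"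
proof (induction k)
  case 0
  then show ?case
    by (simp add: sin_double)
next
  case (Suc k)
  have "2 * sin x * cos (real (2 * Suc k + 1) * x)
      = sin (x + real (2 * Suc k + 1) * x) + sin (x - real (2 * Suc k + 1) * x)"
    by (simp only: mult.assoc sin_times_cos) simp
  also have "x + real (2 * Suc k + 1) * x = real (2 * Suc k + 2) * x"
    by (simp add: algebra_simps)
  also have "x - real (2 * Suc k + 1) * x = - (real (2 * k + 2) * x)"
    by (simp add: algebra_simps)
  finally show ?case
    using Suc.IH by (simp add: distrib_left)
qed

lemma sum_pairs:
  fixes g :: "nat \<Rightarrow> 'a::comm_monoid_add"
  shows "(\<Sum>m<2 * k + 2. g m) = (\<Sum>j\<le>k. g (2 * j) + g (2 * j + 1))"
  by (induction k) (simp_all add: add.assoc numeral_2_eq_2)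

text \<open>Used in \<open>dist_to_curve\<close> to turn a lower bound on the maximum into an angle.
  For \<open>k = 1\<close> the triple-angle formula reduces it to \<open>sin u \<le> 1 / 2\<close>;
  otherwise the sine lies above its chord, whose slope dominates the square root.\<close>

lemma sqrt_mult_sin_le:
  assumes k: "k \<ge> 1" and u: "0 \<le> u" "real (2 * k + 1) * u \<le> pi / 2"
  shows "sqrt (real (2 * k + 2)) * sin u \<le> sin (real (2 * k + 1) * u)"
proof (cases "k = 1")
  case True
  \<comment> \<open>here equality holds at \<open>u = pi / 6\<close>, so the chord bound of the other case is too weak\<close>
  have "sin u \<le> sin (pi / 6)"
    using u True by (intro sin_monotone_2pi_le) auto
  then have "sin u \<le> 1 / 2"
    by (simp add: sin_30)
  moreover have "0 \<le> sin u"
    using u True by (intro sin_ge_zero) auto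
  ultimately have "sin u * (sin u)\<^sup>2 \<le> sin u * (1 / 2)\<^sup>2"
    by (intro mult_left_mono power_mono)
  moreover have "sin (3 * u) = 3 * sin u - 4 * (sin u * (sin u)\<^sup>2)"
  proof -
    have "sin (3 * u) = sin (2 * u + u)"
      by simp
    also have "\<dots> = 2 * sin u * cos u * cos u + (1 - 2 * (sin u)\<^sup>2) * sin u"
      unfolding sin_add sin_double cos_double_sin by simp
    also have "\<dots> = 3 * sin u - 4 * (sin u * (sin u)\<^sup>2)"
    proof -
      have "cos u * cos u = 1 - sin u * sin u"
        using cos_squared_eq[of u] by (simp add: power2_eq_square)
      then show ?thesis
        by (simp only: mult.assoc) (simp add: power2_eq_square algebra_simps)
    qed
    finally show ?thesis .
  qed
  ultimately show ?thesis
    using True by (simp add: power2_eq_square)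
next
  case False
  define N where "N = real (2 * k + 1)"
  have "2 \<le> k"
    using k False by simp
  have "concave_on {0..pi / 2} sin"
    by (rule f''_le0_imp_concave[where f' = cos and f'' = "\<lambda>x. - sin x"])
       (auto intro!: derivative_eq_intros sin_ge_zero)
  then have "(sin (pi / 2) - sin 0) / (pi / 2 - 0) * (N * u - 0) + sin 0 \<le> sin (N * u)"
    using u by (intro concave_onD_Icc') (auto simp: N_def)
  then have jordan: "2 * N / pi * u \<le> sin (N * u)"
    by (simp add: field_simps)
  \<comment> \<open>As \<open>pi < 4\<close>, it suffices that
    \<open>16 * (2 * k + 2) \<le> (2 * N)\<^sup>2\<close>, that is
    \<open>16 * k + 28 \<le> 16 * (k * k)\<close>, which holds from \<open>k = 2\<close> on.\<close>
  have "2 * k \<le> k * k"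
    using \<open>2 \<le> k\<close> by (intro mult_right_mono) auto
  then have "16 * k + 28 \<le> 16 * (k * k)"
    using \<open>2 \<le> k\<close> by linarith
  then have "16 * (2 * k + 2) \<le> (2 * (2 * k + 1)) * (2 * (2 * k + 1))"
    by (simp add: algebra_simps)
  then have "real (16 * (2 * k + 2)) \<le> real ((2 * (2 * k + 1)) * (2 * (2 * k + 1)))"
    by (simp only: of_nat_le_iff)
  then have "16 * real (2 * k + 2) \<le> (2 * N)\<^sup>2"
    by (simp only: N_def power2_eq_square of_nat_mult of_nat_numeral)
  moreover have "pi\<^sup>2 \<le> 4\<^sup>2"
    using pi_less_4 by (intro power_mono) auto
  then have "pi\<^sup>2 * real (2 * k + 2) \<le> 4\<^sup>2 * real (2 * k + 2)"
    by (intro mult_right_mono) auto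
  ultimately have "pi\<^sup>2 * real (2 * k + 2) \<le> (2 * N)\<^sup>2"
    by simp
  then have "sqrt (real (2 * k + 2)) \<le> 2 * N / pi"
    by (intro real_le_lsqrt) (simp_all add: N_def power_divide le_divide_eq mult.commute)
  then have "sqrt (real (2 * k + 2)) * u \<le> 2 * N / pi * u"
    using u(1) by (rule mult_right_mono)
  moreover have "sqrt (real (2 * k + 2)) * sin u \<le> sqrt (real (2 * k + 2)) * u"
    using sin_x_le_x[OF u(1)] by (intro mult_left_mono) auto
  ultimately show ?thesis
    using jordan unfolding N_def by linarith
qed

section \<open>The symmetric trigonometric moment curve\<close>

text \<open>Later arguments see the curve only through its kernel and its pairings, so its
  coordinates stay hidden.\<close>

locale moment_curve =
  fixes k :: nat and \<gamma> :: "real \<Rightarrow> real ^ 'n"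
  assumes card: "CARD('n) = 2 * k + 2"
    and kernel: "\<gamma> s \<bullet> \<gamma> t = (\<Sum>j\<le>k. cos (real (2 * j + 1) * (s - t))) / real (k + 1)"
    and trig: "odd_trig k (\<lambda>s. x \<bullet> \<gamma> s)"

lemma moment_curve_exists:
  assumes card: "CARD('n::finite) = 2 * k + 2"
  shows "\<exists>\<gamma> :: real \<Rightarrow> real ^ 'n. moment_curve k \<gamma>"
proof -
  obtain e :: "'n \<Rightarrow> nat" where e: "bij_betw e UNIV {..<2 * k + 2}"
    using ex_bij_betw_finite_nat[of "UNIV :: 'n set"] card by (auto simp: atLeast0LessThan)
  define g where "g = inv_into UNIV e"
  have g: "g (e i) = i" for i
    using e by (simp add: g_def bij_betw_def)
  \<comment> \<open>Indices \<open>2 * j\<close> and \<open>2 * j + 1\<close> carry the cosine and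
    the sine of the same frequency \<open>2 * j + 1\<close>. Each of the \<open>k + 1\<close> pairs
    has squares adding up to 1, hence the normalization by \<open>r\<close>.\<close>
  define u where "u = (\<lambda>m t. if even m then cos (real (m + 1) * t) else sin (real m * t))"
  define r where "r = sqrt (real (k + 1))"
  define \<gamma> :: "real \<Rightarrow> real ^ 'n" where "\<gamma> = (\<lambda>t. \<chi> i. u (e i) t / r)"
  have reindex: "(\<Sum>i\<in>UNIV. h (e i)) = (\<Sum>j\<le>k. h (2 * j) + h (2 * j + 1))" for h :: "nat \<Rightarrow> real"
    by (simp only: sum.reindex_bij_betw[OF e] sum_pairs)
  have "moment_curve k \<gamma>"
  proof
    show "\<gamma> s \<bullet> \<gamma> t = (\<Sum>j\<le>k. cos (real (2 * j + 1) * (s - t))) / real (k + 1)" for s t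
    proof -
      have "\<gamma> s \<bullet> \<gamma> t = (\<Sum>i\<in>UNIV. u (e i) s * u (e i) t / real (k + 1))"
        by (simp add: \<gamma>_def inner_vec_def r_def)
      also have "\<dots> = (\<Sum>j\<le>k. u (2 * j) s * u (2 * j) t / real (k + 1)
          + u (2 * j + 1) s * u (2 * j + 1) t / real (k + 1))"
        by (rule reindex)
      also have "\<dots> = (\<Sum>j\<le>k. cos (real (2 * j + 1) * (s - t)) / real (k + 1))"
        by (rule sum.cong) (simp_all add: u_def right_diff_distrib cos_diff add_divide_distrib)
      finally show ?thesis
        by (simp add: sum_divide_distrib)
    qed
    show "odd_trig k (\<lambda>s. x \<bullet> \<gamma> s)" for x
    proof (rule odd_trigI)
      fix s
      have "x \<bullet> \<gamma> s = (\<Sum>i\<in>UNIV. x $ g (e i) * u (e i) s / r)"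
        by (simp add: \<gamma>_def inner_vec_def g)
      also have "\<dots> = (\<Sum>j\<le>k. x $ g (2 * j) * u (2 * j) s / r
          + x $ g (2 * j + 1) * u (2 * j + 1) s / r)"
        by (rule reindex)
      \<comment> \<open>The negative imaginary part compensates the sign in the real part of the
        product, leaving cosine and sine terms with the wanted coefficients.\<close>
      also have "\<dots> = (\<Sum>j\<le>k. Re (Complex (x $ g (2 * j) / r) (- x $ g (2 * j + 1) / r)
          * cis (real (2 * j + 1) * s)))"
        by (rule sum.cong) (simp_all add: u_def)
      finally show "x \<bullet> \<gamma> s = \<dots>" .
    qed
  qed (rule card)
  then show ?thesis
    by blast
qed

context moment_curve
begin

lemma norm_curve: "norm (\<gamma> t) = 1"
  using kernel[of t t] by (simp add: norm_eq_1)

lemma curve_in_sphere: "\<gamma> t \<in> sphere 0 1"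
  by (simp add: norm_curve)

text \<open>The points of the curve at the multiples of \<open>pi / (2k+2)\<close> form an orthonormal basis.\<close>

lemma parseval:
  "(\<Sum>i<2 * k + 2. (x \<bullet> \<gamma> (real i * pi / real (2 * k + 2)))\<^sup>2) = (norm x)\<^sup>2"
proof -
  define N where "N = real (2 * k + 2)"
  have N: "0 < N"
    by (simp add: N_def)
  obtain e :: "'n \<Rightarrow> nat" where e: "bij_betw e UNIV {..<2 * k + 2}"
    using ex_bij_betw_finite_nat[of "UNIV :: 'n set"] card by (auto simp: atLeast0LessThan)
  define p where "p = (\<lambda>i. \<gamma> (real i * pi / N))"
  have orth: "p i \<bullet> p j = 0" if "i \<noteq> j" "i < 2 * k + 2" "j < 2 * k + 2" for i j
  proof -
    define x where "x = real i * pi / N - real j * pi / N"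
    have x: "x = (real i - real j) / N * pi"
      by (simp add: x_def algebra_simps diff_divide_distrib)
    have "N * x = of_int (int i - int j) * pi"
      using N by (simp add: x)
    then have "sin (N * x) = 0"
      unfolding sin_zero_iff_int2 by blast
    then have "2 * sin x * (\<Sum>l\<le>k. cos (real (2 * l + 1) * x)) = 0"
      using sin_mult_sum_cos_odd[of x k] by (simp only: N_def)
    \<comment> \<open>Distinct \<open>i\<close> and \<open>j\<close> differ by less than
      \<open>2 * k + 2\<close>, so \<open>x\<close> is no multiple of \<open>pi\<close>.\<close>
    moreover have "sin x \<noteq> 0"
    proof
      assume "sin x = 0"
      then obtain n :: int where "x = of_int n * pi"
        by (auto simp: sin_zero_iff_int2)
      then have "(real i - real j) / N = of_int n"
        using x pi_gt_zero by (metis mult_right_cancel less_irrefl)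
      then have n: "real_of_int (int i - int j) = real_of_int (n * int (2 * k + 2))"
        using N by (simp add: divide_eq_eq) (simp add: N_def)
      then have "int (2 * k + 2) dvd int i - int j"
        by (simp only: of_int_eq_iff) simp
      then have "i mod (2 * k + 2) = j mod (2 * k + 2)"
        by (metis mod_eq_dvd_iff of_nat_eq_iff zmod_int)
      then show False
        using that by simp
    qed
    ultimately show ?thesis
      by (simp add: p_def kernel x_def)
  qed
  \<comment> \<open>The sample points are the rows of \<open>A\<close>. Being orthonormal, they make
    \<open>A\<close> an isometry, and the identity compares the norms of \<open>A *v x\<close> and
    \<open>x\<close>.\<close>
  define A :: "real ^ 'n ^ 'n" where "A = (\<chi> i. p (e i))"
  have "e i < 2 * k + 2" for i
    using e by (auto simp: bij_betw_def)
  moreover have "e i \<noteq> e j" if "i \<noteq> j" for i j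
    using e that by (auto simp: bij_betw_def dest: injD)
  ultimately have "p (e i) \<bullet> p (e j) = 0" if "i \<noteq> j" for i j
    using orth that by blast
  moreover have "norm (p i) = 1" for i
    by (simp add: p_def norm_curve)
  ultimately have "orthogonal_matrix A"
    unfolding orthogonal_matrix_orthonormal_rows
    by (auto simp: A_def row_def vec_lambda_eta orthogonal_def)
  then have "orthogonal_transformation ((*v) A)"
    by (simp add: orthogonal_transformation_matrix)
  then have "norm (A *v x) = norm x"
    by (rule orthogonal_transformation_norm)
  moreover have "(norm (A *v x))\<^sup>2 = (\<Sum>i\<in>UNIV. (x \<bullet> p (e i))\<^sup>2)"
    by (simp add: norm_vec_def L2_set_def sum_nonneg matrix_vector_mul_component A_def inner_commute)
  moreover have "(\<Sum>i\<in>UNIV. (x \<bullet> p (e i))\<^sup>2) = (\<Sum>i<2 * k + 2. (x \<bullet> p i)\<^sup>2)"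
    using e by (rule sum.reindex_bij_betw)
  ultimately show ?thesis
    by (simp add: p_def N_def)
qed

section \<open>Nearest points on the curve\<close>

text \<open>Ties are kept, so compatibility with the antipodal maps needs no choice of a
  maximizer.\<close>

definition maximizes :: "real \<Rightarrow> real ^ 'n \<Rightarrow> bool"
  where "maximizes t x \<longleftrightarrow> (\<forall>s. x \<bullet> \<gamma> s \<le> x \<bullet> \<gamma> t)"

lemma curve_maximizes: "maximizes t (\<gamma> t)"
  unfolding maximizes_def
proof
  show "\<gamma> t \<bullet> \<gamma> s \<le> \<gamma> t \<bullet> \<gamma> t" for s
    using norm_cauchy_schwarz[of "\<gamma> t" "\<gamma> s"] by (simp add: norm_curve dot_square_norm)
qed

lemma maximizes_periodic:
  assumes "maximizes t x"
  shows "maximizes (t + 2 * pi * of_int n) x"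
  using assms odd_trig_periodic[OF trig] by (simp add: maximizes_def)

lemma maximizes_antipode:
  assumes "maximizes t x"
  shows "maximizes (t + pi) (- x)"
  unfolding maximizes_def
proof
  fix s
  have "x \<bullet> \<gamma> (s - pi) \<le> x \<bullet> \<gamma> t"
    using assms by (simp add: maximizes_def)
  then show "- x \<bullet> \<gamma> s \<le> - x \<bullet> \<gamma> (t + pi)"
    using odd_trig_antiperiodic[OF trig, of x "s - pi"] odd_trig_antiperiodic[OF trig, of x t] by simp
qed

lemma maximizes_exists: "\<exists>t. maximizes t x"
proof -
  let ?Q = "\<lambda>s. x \<bullet> \<gamma> s"
  have "\<exists>t\<in>{0..2 * pi}. \<forall>s\<in>{0..2 * pi}. ?Q s \<le> ?Q t"
    by (intro continuous_attains_sup odd_trig_continuous[OF trig]) auto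
  then obtain t where t: "\<And>s. s \<in> {0..2 * pi} \<Longrightarrow> ?Q s \<le> ?Q t"
    by blast
  have "?Q s \<le> ?Q t" for s
  proof -
    define n where "n = \<lfloor>s / (2 * pi)\<rfloor>"
    have "of_int n \<le> s / (2 * pi)" "s / (2 * pi) \<le> of_int n + 1"
      unfolding n_def by linarith+
    then have "2 * pi * of_int n \<le> s" "s \<le> 2 * pi * of_int n + 2 * pi"
      by (simp_all add: field_simps)
    then have "s + 2 * pi * of_int (- n) \<in> {0..2 * pi}"
      by simp
    then show ?thesis
      using t odd_trig_periodic[OF trig, of x s "- n"] by metis
  qed
  then show ?thesis
    unfolding maximizes_def by blast
qed

lemma maximizes_bound:
  assumes "maximizes t x"
  shows "\<bar>x \<bullet> \<gamma> s\<bar> \<le> x \<bullet> \<gamma> t"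
proof -
  have "x \<bullet> \<gamma> s \<le> x \<bullet> \<gamma> t" "x \<bullet> \<gamma> (s + pi) \<le> x \<bullet> \<gamma> t"
    using assms unfolding maximizes_def by blast+
  then show ?thesis
    using odd_trig_antiperiodic[OF trig, of x s] by simp
qed

text \<open>In the orthonormal basis of \<open>parseval\<close>, each of the
  \<open>2 * k + 2\<close> squared coordinates of \<open>x\<close> is at most the squared
  maximum.\<close>

lemma norm_le_maximum:
  assumes "maximizes t x"
  shows "norm x \<le> sqrt (real (2 * k + 2)) * (x \<bullet> \<gamma> t)"
proof -
  have nonneg: "0 \<le> x \<bullet> \<gamma> t"
    using maximizes_bound[OF assms, of t] by simp
  have "(norm x)\<^sup>2 \<le> (\<Sum>i<2 * k + 2. (x \<bullet> \<gamma> t)\<^sup>2)"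
    unfolding parseval[of x, symmetric]
    using maximizes_bound[OF assms] by (intro sum_mono abs_le_square_iff[THEN iffD1]) (simp add: nonneg)
  also have "\<dots> = (sqrt (real (2 * k + 2)) * (x \<bullet> \<gamma> t))\<^sup>2"
    by (simp add: power_mult_distrib)
  finally show ?thesis
    by (rule power2_le_imp_le) (simp add: nonneg)
qed

text \<open>The hypothesis on \<open>u\<close> gives \<open>cos (N * (s - t)) = sin (N * u)\<close>.
  Then \<open>odd_trig_ge_cos\<close>, \<open>norm_le_maximum\<close> and
  \<open>sqrt_mult_sin_le\<close> yield
  \<open>x \<bullet> \<gamma> s \<ge> M * sin (N * u) \<ge> sin u\<close>, the cosine of
  \<open>pi / 2 - u\<close>.\<close>

lemma dist_to_curve:
  assumes k: "k \<ge> 1" and x: "x \<in> sphere 0 1" and max: "maximizes t x"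
    and u: "0 < u" "real (2 * k + 1) * (\<bar>s - t\<bar> + u) = pi / 2"
  shows "sphere_dist x (\<gamma> s) \<le> pi / 2 - u"
proof -
  define N where "N = real (2 * k + 1)"
  have N: "1 \<le> N"
    by (simp add: N_def)
  define M where "M = x \<bullet> \<gamma> t"
  have M: "1 \<le> sqrt (real (2 * k + 2)) * M"
    using norm_le_maximum[OF max] x by (simp add: M_def)
  then have "0 < M"
    by (smt (verit) mult_nonneg_nonpos real_sqrt_ge_zero of_nat_0_le_iff)
  have Nst: "N * \<bar>s - t\<bar> = pi / 2 - N * u"
    using u by (simp add: N_def algebra_simps)
  have "0 < N * u"
    using u N by simp
  then have Nst_less: "N * \<bar>s - t\<bar> < pi"
    unfolding Nst using pi_gt_zero by linarith
  have Nu: "N * u \<le> pi / 2"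
    using Nst N by (smt (verit) mult_nonneg_nonneg)
  have u_le: "u \<le> pi / 2"
    using mult_right_mono[OF N less_imp_le[OF u(1)]] Nu by linarith
  have "sqrt (real (2 * k + 2)) * sin u \<le> sin (N * u)"
    unfolding N_def using k u Nu by (intro sqrt_mult_sin_le) (auto simp: N_def)
  then have "M * (sqrt (real (2 * k + 2)) * sin u) \<le> M * sin (N * u)"
    using \<open>0 < M\<close> by (simp add: mult_left_mono)
  moreover have "0 \<le> sin u"
    using u(1) u_le pi_gt_zero by (intro sin_ge_zero) linarith+
  then have "1 * sin u \<le> (sqrt (real (2 * k + 2)) * M) * sin u"
    using M by (intro mult_right_mono)
  ultimately have "sin u \<le> M * sin (N * u)"
    by (simp add: mult_ac)
  also have "sin (N * u) = cos (N * \<bar>s - t\<bar>)"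
    by (simp add: Nst cos_diff)
  also have "cos (N * \<bar>s - t\<bar>) = cos (N * (s - t))"
    by (metis cos_abs_real abs_mult abs_of_nonneg N order_trans zero_le_one)
  also have "M * cos (N * (s - t)) \<le> x \<bullet> \<gamma> s"
    unfolding N_def using maximizes_bound[OF max] \<open>0 < M\<close> Nst_less
    by (intro odd_trig_ge_cos[OF trig]) (auto simp: M_def N_def)
  finally have "sin u \<le> x \<bullet> \<gamma> s" .
  then have "arccos (x \<bullet> \<gamma> s) \<le> arccos (cos (pi / 2 - u))"
    using sphere_inner_bound[OF x curve_in_sphere[of s]] \<open>0 \<le> sin u\<close>
    by (intro arccos_le_arccos) (auto simp: cos_diff)
  also have "\<dots> = pi / 2 - u"
    using u(1) u_le by (intro arccos_cos) auto
  finally show ?thesis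
    by (simp add: sphere_dist_def)
qed

lemma sphere_dist_le_circle_dist:
  assumes k: "k \<ge> 1" and x: "x \<in> sphere 0 1" "maximizes t x" and y: "y \<in> sphere 0 1" "maximizes t' y"
  shows "sphere_dist x y \<le> 2 * pi * real k / (2 * real k + 1)
    + circle_dist (abs_circle t) (abs_circle t')"
proof -
  define N where "N = real (2 * k + 1)"
  have N: "0 < N"
    by (simp add: N_def)
  have r: "2 * pi * real k / (2 * real k + 1) = pi - pi / N"
    by (simp add: N_def field_simps)
  obtain j :: int where j: "circle_dist (abs_circle t) (abs_circle t') = \<bar>t - t' + 2 * pi * of_int j\<bar>"
    using circle_dist_attained by blast
  define \<epsilon> where "\<epsilon> = \<bar>t - t' + 2 * pi * of_int j\<bar>"
  show ?thesis
  \<comment> \<open>Otherwise the right-hand side is already at least \<open>pi\<close>, the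
    diameter of the sphere.\<close>
  proof (cases "\<epsilon> < pi / N")
    case True
    \<comment> \<open>\<open>t1\<close> represents the same point as \<open>t\<close> and realizes
      the circle distance to \<open>t'\<close>; \<open>s\<close> is the midpoint. \<open>u\<close>
      solves \<open>N * (\<epsilon> / 2 + u) = pi / 2\<close>, so two legs of length
      \<open>pi / 2 - u\<close> add up to \<open>pi - pi / N + \<epsilon>\<close>.\<close>
    define t1 where "t1 = t + 2 * pi * of_int j"
    define s where "s = (t1 + t') / 2"
    define u where "u = (pi / N - \<epsilon>) / 2"
    have t1: "maximizes t1 x"
      unfolding t1_def using x(2) by (rule maximizes_periodic)
    have s: "\<bar>s - t1\<bar> = \<epsilon> / 2" "\<bar>s - t'\<bar> = \<epsilon> / 2"
      by (auto simp: s_def t1_def \<epsilon>_def abs_if field_simps)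
    have u: "0 < u" "N * (\<epsilon> / 2 + u) = pi / 2"
      using True N by (simp_all add: u_def field_simps)
    have "sphere_dist x (\<gamma> s) \<le> pi / 2 - u" "sphere_dist y (\<gamma> s) \<le> pi / 2 - u"
      using dist_to_curve[OF k x(1) t1 u(1), of s] dist_to_curve[OF k y u(1), of s] u(2) s
      by (simp_all add: N_def)
    then have "sphere_dist x y \<le> pi - 2 * u"
      using sphere_dist_triangle[OF x(1) curve_in_sphere[of s] y(1)]
      by (simp add: sphere_dist_commute)
    moreover have "2 * u = pi / N - \<epsilon>"
      by (simp add: u_def)
    ultimately show ?thesis
      unfolding r j \<epsilon>_def[symmetric] by linarith
  next
    case False
    then show ?thesis
      using sphere_dist_le_pi[OF x(1) y(1)] by (simp add: r j \<epsilon>_def[symmetric])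
  qed
qed

end

section \<open>Antipodes and the two-sided estimate\<close>

text \<open>Comparing a minimal difference \<open>w\<close> of representatives with
  \<open>w - 2 * pi\<close> and \<open>w + 2 * pi\<close> forces
  \<open>\<bar>w\<bar> \<le> pi\<close>. One of \<open>w - pi\<close> and \<open>w + pi\<close> then
  has absolute value \<open>pi - \<bar>w\<bar>\<close>.\<close>

lemma circle_dist_le_pi: "circle_dist c c' \<le> pi"
  and circle_dist_antipode_le:
    "circle_dist (abs_circle t) (abs_circle (t' + pi)) \<le> pi - circle_dist (abs_circle t) (abs_circle t')"
proof -
  have *: "\<exists>j::int. circle_dist (abs_circle t) (abs_circle t') = \<bar>t - t' + 2 * pi * of_int j\<bar>
      \<and> \<bar>t - t' + 2 * pi * of_int j\<bar> \<le> pi" for t t'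
  proof -
    obtain j :: int where j: "circle_dist (abs_circle t) (abs_circle t') = \<bar>t - t' + 2 * pi * of_int j\<bar>"
      using circle_dist_attained by blast
    define w where "w = t - t' + 2 * pi * of_int j"
    have "t - t' + 2 * pi * of_int (j - 1) = w - 2 * pi" "t - t' + 2 * pi * of_int (j + 1) = w + 2 * pi"
      by (simp_all add: w_def algebra_simps)
    then have "\<bar>w\<bar> \<le> \<bar>w - 2 * pi\<bar>" "\<bar>w\<bar> \<le> \<bar>w + 2 * pi\<bar>"
      using circle_dist_le[of t t' "j - 1"] circle_dist_le[of t t' "j + 1"] j by (simp_all only: w_def)
    then have "\<bar>w\<bar> \<le> pi"
      using pi_gt_zero by linarith
    then show ?thesis
      using j unfolding w_def by blast
  qed
  show "circle_dist c c' \<le> pi"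
  proof -
    obtain t t' where "c = abs_circle t" "c' = abs_circle t'"
      by (metis Quotient3_abs_rep[OF Quotient3_circle])
    then show ?thesis
      using *[of t t'] by auto
  qed
  obtain j :: int where j: "circle_dist (abs_circle t) (abs_circle t') = \<bar>t - t' + 2 * pi * of_int j\<bar>"
    and le: "\<bar>t - t' + 2 * pi * of_int j\<bar> \<le> pi"
    using * by blast
  show "circle_dist (abs_circle t) (abs_circle (t' + pi)) \<le> pi - circle_dist (abs_circle t) (abs_circle t')"
  proof -
    define w where "w = t - t' + 2 * pi * of_int j"
    have "t - (t' + pi) + 2 * pi * of_int j = w - pi" "t - (t' + pi) + 2 * pi * of_int (j + 1) = w + pi"
      by (simp_all add: w_def algebra_simps)
    then have "circle_dist (abs_circle t) (abs_circle (t' + pi)) \<le> \<bar>w - pi\<bar>"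
      "circle_dist (abs_circle t) (abs_circle (t' + pi)) \<le> \<bar>w + pi\<bar>"
      using circle_dist_le[of t "t' + pi" j] circle_dist_le[of t "t' + pi" "j + 1"] by (simp_all only:)
    then show ?thesis
      using le unfolding j w_def[symmetric] by linarith
  qed
qed

text \<open>The reverse inequality is the one-sided estimate for \<open>- y\<close> and
  \<open>t' + pi\<close>: the antipode replaces the sphere distance by \<open>pi\<close> minus it,
  and the circle distance by at most that.\<close>

lemma (in moment_curve) dist_diff_le:
  assumes k: "k \<ge> 1" and x: "x \<in> sphere 0 1" "maximizes t x" and y: "y \<in> sphere 0 1" "maximizes t' y"
  shows "\<bar>circle_dist (abs_circle t) (abs_circle t') - sphere_dist x y\<bar> \<le> 2 * pi * real k / (2 * real k + 1)"
proof -
  have "- y \<in> sphere 0 1"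
    using y(1) by simp
  then have "sphere_dist x (- y) \<le> 2 * pi * real k / (2 * real k + 1)
      + circle_dist (abs_circle t) (abs_circle (t' + pi))"
    using k x maximizes_antipode[OF y(2)] by (intro sphere_dist_le_circle_dist)
  moreover have "sphere_dist x (- y) = pi - sphere_dist x y"
    using sphere_inner_bound[OF x(1) y(1)] by (simp add: sphere_dist_def arccos_minus abs_le_iff)
  ultimately show ?thesis
    using circle_dist_antipode_le[of t t'] sphere_dist_le_circle_dist[OF k x y] by linarith
qed

section \<open>Gromov-Hausdorff distance from a correspondence\<close>

lemma distortion_nonneg:
  assumes "X \<noteq> {}" and "\<And>x x'. x \<in> X \<Longrightarrow> x' \<in> X \<Longrightarrow> \<bar>dX x x' - dY (f x) (f x')\<bar> \<le> B"
  shows "0 \<le> distortion X dX dY f"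
proof -
  obtain a where "a \<in> X"
    using assms(1) by blast
  have "\<bar>dX a a - dY (f a) (f a)\<bar> \<le> distortion X dX dY f"
    unfolding distortion_def using \<open>a \<in> X\<close> assms(2)
    by (intro cSUP_upper2[where x = "(a, a)"] bdd_aboveI2[where M = B]) auto
  then show ?thesis
    by linarith
qed

text \<open>\<open>R\<close> is a correspondence. With \<open>f\<close> and \<open>h\<close> chosen
  inside it, one bound on related pairs controls both distortions and the codistortion.\<close>

lemma gromov_hausdorff_dist_le:
  assumes X: "X \<noteq> {}" and Y: "Y \<noteq> {}"
    and dX: "\<And>x x'. x \<in> X \<Longrightarrow> x' \<in> X \<Longrightarrow> \<bar>dX x x'\<bar> \<le> B"
    and dY: "\<And>y y'. y \<in> Y \<Longrightarrow> y' \<in> Y \<Longrightarrow> \<bar>dY y y'\<bar> \<le> B"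
    and R: "\<And>x y x' y'. R x y \<Longrightarrow> R x' y' \<Longrightarrow> x \<in> X \<Longrightarrow> x' \<in> X \<Longrightarrow> y \<in> Y \<Longrightarrow> y' \<in> Y \<Longrightarrow>
      \<bar>dX x x' - dY y y'\<bar> \<le> r"
    and total: "\<And>x. x \<in> X \<Longrightarrow> \<exists>y\<in>Y. R x y" "\<And>y. y \<in> Y \<Longrightarrow> \<exists>x\<in>X. R x y"
  shows "2 * gromov_hausdorff_dist X dX Y dY \<le> r"
proof -
  let ?m = "\<lambda>(f, h). Max {distortion X dX dY f, distortion Y dY dX h, codistortion X dX Y dY f h}"
  obtain f where f: "\<And>x. x \<in> X \<Longrightarrow> f x \<in> Y \<and> R x (f x)"
    using total(1) by metis
  obtain h where h: "\<And>y. y \<in> Y \<Longrightarrow> h y \<in> X \<and> R (h y) y"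
    using total(2) by metis
  \<comment> \<open>A real infimum is known to lie below its members only if these are bounded
    below. Here 0 works: the terms of each distortion are at most \<open>2 * B\<close>, so its
    supremum is genuine.\<close>
  have "bdd_below (?m ` ((X \<rightarrow> Y) \<times> (Y \<rightarrow> X)))"
  proof (rule bdd_belowI2[where m = 0])
    fix p assume "p \<in> (X \<rightarrow> Y) \<times> (Y \<rightarrow> X)"
    then obtain f h where p: "p = (f, h)" "f \<in> X \<rightarrow> Y"
      by blast
    have "\<bar>dX x x' - dY (f x) (f x')\<bar> \<le> 2 * B" if "x \<in> X" "x' \<in> X" for x x'
      using dX[OF that] dY[of "f x" "f x'"] p(2) that by fastforce
    then have "0 \<le> distortion X dX dY f"
      by (rule distortion_nonneg[OF X])
    then show "0 \<le> ?m p"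
      by (simp add: p le_max_iff_disj)
  qed
  then have "(INF p \<in> (X \<rightarrow> Y) \<times> (Y \<rightarrow> X). ?m p) \<le> ?m (f, h)"
    using f h by (intro cINF_lower) auto
  also have "\<dots> \<le> r"
  proof -
    have "distortion X dX dY f \<le> r"
      unfolding distortion_def using X f R by (intro cSUP_least) auto
    moreover have "distortion Y dY dX h \<le> r"
    proof -
      have "\<bar>dY y y' - dX (h y) (h y')\<bar> \<le> r" if "y \<in> Y" "y' \<in> Y" for y y'
        using R[of "h y" y "h y'" y'] h that by (simp add: abs_minus_commute)
      then show ?thesis
        unfolding distortion_def using Y by (intro cSUP_least) auto
    qed
    moreover have "codistortion X dX Y dY f h \<le> r"
      unfolding codistortion_def using X Y f h R by (intro cSUP_least) auto
    ultimately show ?thesis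
      by simp
  qed
  finally show ?thesis
    by (simp add: gromov_hausdorff_dist_def)
qed

theorem mainTheorem2:
  fixes k :: nat
  assumes "k \<ge> 1"
    and "CARD('n::finite) = 2 * k + 2"
  shows "2 * gromov_hausdorff_dist
               (UNIV :: circle set) circle_dist
               (sphere 0 1 :: (real ^ 'n) set) sphere_dist
         \<le> 2 * pi * real k / (2 * real k + 1)"
proof -
  obtain \<gamma> :: "real \<Rightarrow> real ^ 'n" where "moment_curve k \<gamma>"
    using moment_curve_exists[OF assms(2)] by blast
  then interpret moment_curve k \<gamma> .
  \<comment> \<open>Quantifying over \<open>t\<close> avoids choosing representatives, as
    \<open>dist_diff_le\<close> holds for all of them.\<close>
  let ?R = "\<lambda>c x. \<exists>t. c = abs_circle t \<and> maximizes t x"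
  show ?thesis
  proof (rule gromov_hausdorff_dist_le[where B = pi and R = ?R])
    show "sphere 0 1 \<noteq> ({} :: (real ^ 'n) set)"
      using curve_in_sphere by blast
    show "\<bar>circle_dist c c'\<bar> \<le> pi" for c c'
      using circle_dist_le_pi Metric_space.nonneg[OF Metric_space_circle] by simp
    show "\<bar>sphere_dist x y\<bar> \<le> pi" if "x \<in> sphere 0 1" "y \<in> sphere 0 1" for x y :: "real ^ 'n"
      using sphere_dist_nonneg[OF that] sphere_dist_le_pi[OF that] by simp
    show "\<exists>x\<in>sphere 0 1. ?R c x" for c
      using curve_in_sphere curve_maximizes by (induction c rule: circle.abs_induct) blast
    show "\<exists>c\<in>UNIV. ?R c x" for x
      using maximizes_exists by blast
    show "\<bar>circle_dist c c' - sphere_dist x y\<bar> \<le> 2 * pi * real k / (2 * real k + 1)"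
      if "?R c x" "?R c' y" "x \<in> sphere 0 1" "y \<in> sphere 0 1" for c c' x y
      using that dist_diff_le[OF assms(1)] by blast
  qed simp
qed

end
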